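(* Fix $l\ge1$, rates $\theta_1,\dots,\theta_l$ and thinning probabilities $p_j^k$, $j=1,2,\dots$, $k=1,\dots,l$. For each $d$ let $\boldsymbol{X}=(X_1,\dots,X_d)$ follow the multivariate thinning-dependence Poisson distribution with background Poisson random variables $Y_1,\dots,Y_l$ of rates $\theta_1,\dots,\theta_l$ and thinning probabilities $p_j^k$, $j=1,\dots,d$, $k=1,\dots,l$. Then for every $x\in\mathbb N=\{0,1,2,\dots\}$, as $d\to\infty$, $$F_{M^{\boldsymbol X}}(x)\sim F_{Y_1}*F_{Y_2}*\cdots*F_{Y_l}(x),\qquad F_{m^{\boldsymbol X}}(x)\sim1,$$ where $*$ denotes the convolution operator, so that $F_{Y_1}*\cdots*F_{Y_l}$ is the cumulative distribution function of $Y_1+\cdots+Y_l$.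
   Context: Multivariate thinning-dependence Poisson distribution: let $Y_1,\dots,Y_l$ be independent Poisson random variables with rates $\theta_1,\dots,\theta_l>0$, let $p_j^k\in[0,1]$ for $j=1,\dots,d$, $k=1,\dots,l$, and let $\boldsymbol X=(X_1,\dots,X_d)$ with $X_j=\sum_{k=1}^{l}X_j^k$. The vector $\boldsymbol X$ follows the multivariate thinning-dependence Poisson distribution if: (i) conditionally on $Y_k=y_k$, $X_j^k$ is binomial with parameters $y_k$ and $p_j^k$, i.e. $\mathbb P(X_j^k=z\mid Y_k=y_k)=\binom{y_k}{z}(p_j^k)^z(1-p_j^k)^{y_k-z}$ for $0\le z\le y_k$; (ii) for each $k$, $X_1^k,\dots,X_d^k$ are conditionally independent given $Y_k=y_k$; (iii) the $l$ random vectors $(Y_1,X_1^1,\dots,X_d^1),\dots,(Y_l,X_1^l,\dots,X_d^l)$ are independent. $M^{\boldsymbol X}=\max(X_1,\dots,X_d)$, $m^{\boldsymbol X}=\min(X_1,\dots,X_d)$. $F_W$ denotes the cumulative distribution function of a random variable $W$. The notation $f(x;\kappa)\sim g(x;\kappa)$ as $\kappa\to\kappa_0$ means $\lim_{\kappa\to\kappa_0}f(x;\kappa)/g(x;\kappa)=1$.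
   Formalization: The claim for the maximum (minimum) is proved under the added condition that for every y in N^l, with q=p (q=1-p) and r_j=∏_k (q_j^k)^{y_k}, some r_j=1 or Σ_j r_j=∞; without it the claim fails, e.g. if all p_j^k=0 (all p_j^k=1). *)

theory Defs
  imports "HOL-Probability.Probability"
begin

text \<open>
  Indices run over \<open>j \<in> {1..d}\<close> and \<open>k \<in> {1..l}\<close>; \<open>X j k\<close> is the variable written
  \<open>X\<^sub>j\<^sup>k\<close>, and \<open>p j k\<close> the thinning probability \<open>p\<^sub>j\<^sup>k\<close>.
\<close>

locale thinning_dependence_poisson = prob_space M
  for M :: "'a measure" +
  fixes d l :: nat
    and \<theta> :: "nat \<Rightarrow> real"
    and p :: "nat \<Rightarrow> nat \<Rightarrow> real"
    and Y :: "nat \<Rightarrow> 'a \<Rightarrow> nat"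
    and X :: "nat \<Rightarrow> nat \<Rightarrow> 'a \<Rightarrow> nat"
  assumes rate_pos: "\<And>k. k \<in> {1..l} \<Longrightarrow> \<theta> k > 0"
    and thinning_prob: "\<And>j k. j \<in> {1..d} \<Longrightarrow> k \<in> {1..l} \<Longrightarrow> p j k \<in> {0..1}"
    and Y_measurable: "\<And>k. k \<in> {1..l} \<Longrightarrow> Y k \<in> measurable M (count_space UNIV)"
    and X_measurable: "\<And>j k. j \<in> {1..d} \<Longrightarrow> k \<in> {1..l} \<Longrightarrow>
          X j k \<in> measurable M (count_space UNIV)"
    and Y_poisson: "\<And>k. k \<in> {1..l} \<Longrightarrow>
          distr M (count_space UNIV) (Y k) = measure_pmf (poisson_pmf (\<theta> k))"
    and Y_indep: "indep_vars (\<lambda>_. count_space UNIV) Y {1..l}"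
    and X_cond_binomial: "\<And>j k y z. j \<in> {1..d} \<Longrightarrow> k \<in> {1..l} \<Longrightarrow> z \<le> y \<Longrightarrow>
          \<P>(\<omega> in M. X j k \<omega> = z \<bar> Y k \<omega> = y)
            = real (y choose z) * p j k ^ z * (1 - p j k) ^ (y - z)"
    \<comment> \<open>\<open>uniform_measure M A\<close> is the conditional probability measure given the event \<open>A\<close>,
        which has positive probability here.\<close>
    and X_cond_indep: "\<And>k y. k \<in> {1..l} \<Longrightarrow>
          prob_space.indep_vars (uniform_measure M {\<omega> \<in> space M. Y k \<omega> = y})
            (\<lambda>_. count_space UNIV) (\<lambda>j. X j k) {1..d}"
    and vectors_indep:
          "indep_vars (\<lambda>_. count_space UNIV \<Otimes>\<^sub>M PiM {1..d} (\<lambda>_. count_space UNIV))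
            (\<lambda>k \<omega>. (Y k \<omega>, \<lambda>j\<in>{1..d}. X j k \<omega>)) {1..l}"

definition component :: "nat \<Rightarrow> (nat \<Rightarrow> nat \<Rightarrow> 'a \<Rightarrow> nat) \<Rightarrow> nat \<Rightarrow> 'a \<Rightarrow> nat" where
  "component l X j \<omega> = (\<Sum>k\<in>{1..l}. X j k \<omega>)"

definition max_component :: "nat \<Rightarrow> nat \<Rightarrow> (nat \<Rightarrow> nat \<Rightarrow> 'a \<Rightarrow> nat) \<Rightarrow> 'a \<Rightarrow> nat" where
  "max_component d l X \<omega> = Max ((\<lambda>j. component l X j \<omega>) ` {1..d})"

definition min_component :: "nat \<Rightarrow> nat \<Rightarrow> (nat \<Rightarrow> nat \<Rightarrow> 'a \<Rightarrow> nat) \<Rightarrow> 'a \<Rightarrow> nat" where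
  "min_component d l X \<omega> = Min ((\<lambda>j. component l X j \<omega>) ` {1..d})"

definition rv_cdf :: "'a measure \<Rightarrow> ('a \<Rightarrow> nat) \<Rightarrow> real \<Rightarrow> real" where
  "rv_cdf M W = cdf (distr M borel (\<lambda>\<omega>. real (W \<omega>)))"

text \<open>
  Convolution of cumulative distribution functions is the Lebesgue-Stieltjes integral
  \<open>(F * G)(x) = \<integral> F(x - t) dG(t)\<close>.
\<close>

definition cdf_convolution :: "(real \<Rightarrow> real) \<Rightarrow> (real \<Rightarrow> real) \<Rightarrow> real \<Rightarrow> real" where
  "cdf_convolution F G x = (\<integral>t. F (x - t) \<partial>interval_measure G)"

text \<open>\<open>F 1 * F 2 * \<dots> * F l\<close>, for \<open>l \<ge> 1\<close>:\<close>

definition cdf_convolutions :: "(nat \<Rightarrow> real \<Rightarrow> real) \<Rightarrow> nat \<Rightarrow> real \<Rightarrow> real" where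
  "cdf_convolutions F l = foldl cdf_convolution (F 1) (map F [2..<Suc l])"

text \<open>
  Given \<open>Y\<^sub>k = y\<^sub>k\<close> for all \<open>k\<close>, the component \<open>X\<^sub>j\<close> attains its largest possible value
  \<open>y\<^sub>1 + \<dots> + y\<^sub>l\<close> with probability \<open>\<Prod>\<^sub>k (p\<^sub>j\<^sup>k)\<^bsup>y\<^sub>k\<^esup>\<close>, and the value \<open>0\<close> with
  probability \<open>\<Prod>\<^sub>k (1 - p\<^sub>j\<^sup>k)\<^bsup>y\<^sub>k\<^esup>\<close>, independently over \<open>j\<close>. The predicate below, used with
  \<open>q = p\<close> and \<open>q = 1 - p\<close>, says that for every \<open>y\<close> these events, \<open>j = 1, 2, \<dots>\<close>, have
  probabilities \<open>r\<^sub>j\<close> with \<open>\<Prod>\<^sub>j (1 - r\<^sub>j) = 0\<close>. Without such a condition the limits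
  of the maximum and the minimum are different: if all \<open>p\<^sub>j\<^sup>k = 0\<close> then the maximum is
  constantly \<open>0\<close>, and if all \<open>p\<^sub>j\<^sup>k = 1\<close> then the minimum is \<open>Y\<^sub>1 + \<dots> + Y\<^sub>l\<close>. It holds
  in particular when \<open>q j k \<ge> \<epsilon>\<close> for all \<open>k\<close> and infinitely many \<open>j\<close>, for some \<open>\<epsilon> > 0\<close>.
\<close>

definition eventually_attaining :: "nat \<Rightarrow> (nat \<Rightarrow> nat \<Rightarrow> real) \<Rightarrow> bool" where
  "eventually_attaining l q \<longleftrightarrow> (\<forall>y :: nat \<Rightarrow> nat.
     (\<exists>j\<ge>1. (\<Prod>k\<in>{1..l}. q j k ^ y k) = 1) \<or>
     \<not> summable (\<lambda>j. \<Prod>k\<in>{1..l}. q (Suc j) k ^ y k))"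

end

theory Submission
  imports Defs
begin

text \<open>
  Given the background counts \<open>Y\<^sub>1, \<dots>, Y\<^sub>l\<close>, the events that \<open>X\<^sub>j\<close> attains its largest possible
  value \<open>S = Y\<^sub>1 + \<dots> + Y\<^sub>l\<close> are independent over \<open>j\<close>, and so are the events that it attains \<open>0\<close>.
  Under the attainment condition a Borel-Cantelli product makes the conditional probability that no
  \<open>X\<^sub>j\<close> with \<open>j \<le> d\<close> does so tend to \<open>0\<close>, and since the law of \<open>Y\<close> does not depend on \<open>d\<close>, truncating
  \<open>Y\<close> to a finite box carries this over to the unconditional probability. Off this exceptional event
  the maximum is \<open>S\<close>, respectively the minimum is \<open>0\<close>; together with \<open>max X \<le> S\<close> almost surely and
  the uniform bound \<open>P(S \<le> x) \<ge> P(S = 0) > 0\<close> this gives both limits.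
\<close>

section \<open>Convolutions of distribution functions and sums of independent variables\<close>

text \<open>A distribution function determines its law, so the Lebesgue-Stieltjes integral in
  \<open>cdf_convolution\<close> becomes an integral against the law of the variable.\<close>

lemma interval_measure_cdf:
  assumes "real_distribution \<mu>"
  shows "interval_measure (cdf \<mu>) = \<mu>"
proof -
  interpret real_distribution \<mu> by fact
  show ?thesis
  proof (rule cdf_unique)
    show "real_distribution (interval_measure (cdf \<mu>))"
      by (intro real_distribution_interval_measure cdf_nondecreasing cdf_is_right_cont
          cdf_lim_at_bot cdf_lim_at_top_prob)
    show "cdf (interval_measure (cdf \<mu>)) = cdf \<mu>"
      by (intro cdf_interval_measure cdf_nondecreasing cdf_is_right_cont cdf_lim_at_bot)
  qed fact
qed

text \<open>By independence the law of the sum is the convolution of the two laws. Evaluated on the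
  half-line \<open>{..x}\<close>, its inner measure is that of the shifted half-line
  \<open>{..x - t}\<close>, which is the first distribution function at
  \<open>x - t\<close>.\<close>

lemma (in prob_space) cdf_convolution_indep_var:
  assumes ind: "indep_var borel V borel W"
  shows "cdf_convolution (cdf (distr M borel W)) (cdf (distr M borel V)) =
    cdf (distr M borel (\<lambda>\<omega>. V \<omega> + W \<omega>))"
proof
  fix x
  have [measurable]: "random_variable borel V" "random_variable borel W"
    using ind by (auto dest: indep_var_rv1 indep_var_rv2)
  interpret V: real_distribution "distr M borel V" by simp
  interpret W: real_distribution "distr M borel W" by simp
  interpret S: real_distribution "distr M borel (\<lambda>\<omega>. V \<omega> + W \<omega>)" by simp
  let ?F = "cdf (distr M borel W)"
  have F[measurable]: "?F \<in> borel_measurable borel"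
    by (intro borel_measurable_mono monoI W.cdf_nondecreasing)
  have "emeasure (distr M borel (\<lambda>\<omega>. V \<omega> + W \<omega>)) {..x} =
      (\<integral>\<^sup>+t. emeasure (distr M borel W) {a. a + t \<in> {..x}} \<partial>distr M borel V)"
    unfolding sum_indep_random_variable[OF ind \<open>random_variable borel V\<close> \<open>random_variable borel W\<close>]
    by (intro convolution_emeasure) (auto intro: V.finite_measure_axioms W.finite_measure_axioms)
  also have "\<dots> = (\<integral>\<^sup>+t. ennreal (?F (x - t)) \<partial>distr M borel V)"
  proof (rule nn_integral_cong)
    fix t
    have "{a. a + t \<in> {..x}} = {..x - t}"
      by auto
    then show "emeasure (distr M borel W) {a. a + t \<in> {..x}} = ennreal (?F (x - t))"
      by (simp add: cdf_def W.emeasure_eq_measure)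
  qed
  also have "\<dots> = ennreal (\<integral>t. ?F (x - t) \<partial>distr M borel V)"
    by (intro nn_integral_eq_integral V.integrable_const_bound[where B=1])
      (auto simp: W.cdf_nonneg W.cdf_bounded_prob)
  finally have "ennreal (cdf (distr M borel (\<lambda>\<omega>. V \<omega> + W \<omega>)) x) =
      ennreal (\<integral>t. ?F (x - t) \<partial>distr M borel V)"
    by (simp add: cdf_def S.emeasure_eq_measure)
  then have "cdf (distr M borel (\<lambda>\<omega>. V \<omega> + W \<omega>)) x = (\<integral>t. ?F (x - t) \<partial>distr M borel V)"
    by (subst (asm) ennreal_inj) (auto intro!: integral_nonneg_AE simp: W.cdf_nonneg S.cdf_nonneg)
  then show "cdf_convolution ?F (cdf (distr M borel V)) x =
      cdf (distr M borel (\<lambda>\<omega>. V \<omega> + W \<omega>)) x"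
    by (simp add: cdf_convolution_def interval_measure_cdf)
qed

text \<open>Induction on the number of factors: \<open>foldl\<close> convolves the accumulated
  distribution function with that of the next variable, and the next variable is independent of the
  sum of the earlier ones.\<close>

lemma (in prob_space) cdf_convolutions_indep_vars:
  assumes ind: "indep_vars (\<lambda>_. count_space UNIV) Y {1..l}" and "1 \<le> l"
  shows "cdf_convolutions (\<lambda>k. rv_cdf M (Y k)) l = rv_cdf M (\<lambda>\<omega>. \<Sum>k\<in>{1..l}. Y k \<omega>)"
  using \<open>1 \<le> l\<close> ind
proof (induction l rule: dec_induct)
  case base
  then show ?case
    by (simp add: cdf_convolutions_def)
next
  case (step n)
  have ind: "indep_vars (\<lambda>_. borel) (\<lambda>k \<omega>. real (Y k \<omega>)) (insert (Suc n) {1..n})"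
    using indep_vars_compose2[OF step.prems, of "\<lambda>_. real" "\<lambda>_. borel"]
    by (simp add: atLeastAtMostSuc_conv)
  have IH: "cdf_convolutions (\<lambda>k. rv_cdf M (Y k)) n = rv_cdf M (\<lambda>\<omega>. \<Sum>k\<in>{1..n}. Y k \<omega>)"
    by (intro step.IH indep_vars_subset[OF step.prems]) auto
  have "cdf_convolutions (\<lambda>k. rv_cdf M (Y k)) (Suc n) =
      cdf_convolution (rv_cdf M (\<lambda>\<omega>. \<Sum>k\<in>{1..n}. Y k \<omega>)) (rv_cdf M (Y (Suc n)))"
    using step.hyps IH by (simp add: cdf_convolutions_def)
  also have "\<dots> = rv_cdf M (\<lambda>\<omega>. \<Sum>k\<in>{1..Suc n}. Y k \<omega>)"
    using cdf_convolution_indep_var[OF indep_vars_sum[OF _ _ ind]]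
    by (simp add: rv_cdf_def add.commute)
  finally show ?case .
qed

section \<open>Auxiliary identities for probabilities\<close>

text \<open>Conditional independence given \<open>B\<close> passes to complements. Writing it with
  products avoids dividing by \<open>prob B\<close>.\<close>

lemma (in prob_space) prob_Diff_UN_indep:
  assumes "finite K" "B \<in> events" "\<And>j. j \<in> K \<Longrightarrow> A j \<in> events"
    and "\<And>J. J \<subseteq> K \<Longrightarrow> prob {\<omega> \<in> B. \<forall>j\<in>J. \<omega> \<in> A j} = prob B * (\<Prod>j\<in>J. r j)"
  shows "prob (B - (\<Union>j\<in>K. A j)) = prob B * (\<Prod>j\<in>K. 1 - r j)"
  using assms
proof (induction K arbitrary: B rule: finite_induct)
  case empty
  then show ?case by simp
next
  case (insert i K)
  have [measurable]: "B \<in> events" "A i \<in> events" "(\<Union>j\<in>K. A j) \<in> events"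
    using insert by auto
  have B_i: "prob (B \<inter> A i) = prob B * r i"
    using insert.prems(3)[of "{i}"] by (simp add: Int_def)
  \<comment> \<open>This is why \<open>B\<close> is arbitrary in the induction:
    \<open>B \<inter> A i\<close> satisfies the same factorisation over \<open>K\<close>, with the
    same \<open>r\<close>. Subtracting this identity from the one for \<open>B\<close> produces the
    new factor \<open>1 - r i\<close>.\<close>
  have "prob (B \<inter> A i - (\<Union>j\<in>K. A j)) = prob (B \<inter> A i) * (\<Prod>j\<in>K. 1 - r j)"
  proof (rule insert.IH)
    fix J assume J: "J \<subseteq> K"
    then have "finite J" "i \<notin> J"
      using insert.hyps by (auto intro: finite_subset)
    moreover have "{\<omega> \<in> B \<inter> A i. \<forall>j\<in>J. \<omega> \<in> A j} = {\<omega> \<in> B. \<forall>j\<in>insert i J. \<omega> \<in> A j}"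
      by auto
    ultimately show "prob {\<omega> \<in> B \<inter> A i. \<forall>j\<in>J. \<omega> \<in> A j} = prob (B \<inter> A i) * (\<Prod>j\<in>J. r j)"
      using insert.prems(3)[of "insert i J"] J by (simp add: B_i mult.assoc subset_insertI2)
  qed (use insert.prems in auto)
  moreover have "prob (B - (\<Union>j\<in>K. A j)) = prob B * (\<Prod>j\<in>K. 1 - r j)"
    using insert.prems by (intro insert.IH) auto
  moreover have "B - (\<Union>j\<in>insert i K. A j) = (B - (\<Union>j\<in>K. A j)) - (B \<inter> A i - (\<Union>j\<in>K. A j))"
    by auto
  moreover have "prob \<dots> = prob (B - (\<Union>j\<in>K. A j)) - prob (B \<inter> A i - (\<Union>j\<in>K. A j))"
    by (intro finite_measure_Diff) auto
  ultimately show ?case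
    using insert.hyps by (simp add: B_i algebra_simps)
qed

lemma (in prob_space) rv_cdf_eq_prob:
  assumes [measurable]: "W \<in> measurable M (count_space UNIV)"
  shows "rv_cdf M W (real x) = prob {\<omega> \<in> space M. W \<omega> \<le> x}"
proof -
  have "rv_cdf M W (real x) = prob ((\<lambda>\<omega>. real (W \<omega>)) -` {..real x} \<inter> space M)"
    unfolding rv_cdf_def cdf_def by (intro measure_distr) auto
  also have "(\<lambda>\<omega>. real (W \<omega>)) -` {..real x} \<inter> space M = {\<omega> \<in> space M. W \<omega> \<le> x}"
    by auto
  finally show ?thesis .
qed

section \<open>Probability of missing a prescribed value in a fixed dimension\<close>

context thinning_dependence_poisson
begin

lemma measurable_components[measurable (raw)]:
  "k \<in> {1..l} \<Longrightarrow> Y k \<in> measurable M (count_space UNIV)"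
  "j \<in> {1..d} \<Longrightarrow> k \<in> {1..l} \<Longrightarrow> X j k \<in> measurable M (count_space UNIV)"
  using Y_measurable X_measurable by auto

lemma prob_Y:
  assumes k: "k \<in> {1..l}"
  shows "prob {\<omega> \<in> space M. Y k \<omega> \<in> A} = measure_pmf.prob (poisson_pmf (\<theta> k)) A"
proof -
  have "measure_pmf.prob (poisson_pmf (\<theta> k)) A = prob (Y k -` A \<inter> space M)"
    using k by (simp add: Y_poisson[symmetric] measure_distr measurable_components)
  also have "Y k -` A \<inter> space M = {\<omega> \<in> space M. Y k \<omega> \<in> A}"
    by auto
  finally show ?thesis by simp
qed

lemma prob_Y_eq:
  assumes "k \<in> {1..l}"
  shows "prob {\<omega> \<in> space M. Y k \<omega> = y} = \<theta> k ^ y / fact y * exp (- \<theta> k)"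
  using prob_Y[OF assms, of "{y}"] rate_pos[OF assms] by (simp add: measure_pmf_single)

lemma prob_Y_pos: "k \<in> {1..l} \<Longrightarrow> 0 < prob {\<omega> \<in> space M. Y k \<omega> = y}"
  using rate_pos[of k] by (simp add: prob_Y_eq)

text \<open>Conditional independence over \<open>j\<close> for a single \<open>k\<close>, moved from
  the conditional measure back to \<open>M\<close>; this is legitimate because a Poisson variable
  takes every value with positive probability.\<close>

lemma prob_component_hits:
  assumes k: "k \<in> {1..l}" and J: "J \<subseteq> {1..d}"
  shows "prob {\<omega> \<in> space M. Y k \<omega> = y \<and> (\<forall>j\<in>J. X j k \<omega> = v)} =
    prob {\<omega> \<in> space M. Y k \<omega> = y} * (\<Prod>j\<in>J. \<P>(\<omega> in M. X j k \<omega> = v \<bar> Y k \<omega> = y))"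
\<comment> \<open>\<open>indep_varsD\<close> needs a nonempty index set; for empty \<open>J\<close>
  the product is \<open>1\<close>.\<close>
proof (cases "J = {}")
  case False
  let ?B = "{\<omega> \<in> space M. Y k \<omega> = y}"
  let ?U = "uniform_measure M ?B"
  have fin: "finite J"
    using J by (rule finite_subset) simp
  have [measurable]: "Y k \<in> measurable M (count_space UNIV)"
    using k by measurable
  have X[measurable]: "X j k \<in> measurable M (count_space UNIV)" if "j \<in> J" for j
    using k J that by (intro measurable_components) auto
  have pos: "emeasure M ?B \<noteq> 0"
    using prob_Y_pos[OF k, of y] by (simp add: emeasure_eq_measure)
  interpret U: prob_space ?U
    using pos by (intro prob_space_uniform_measure) auto
  have "prob {\<omega> \<in> space M. Y k \<omega> = y \<and> (\<forall>j\<in>J. X j k \<omega> = v)} =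
      prob (?B \<inter> (\<Inter>j\<in>J. X j k -` {v} \<inter> space M))"
    using False by (intro arg_cong[where f=prob]) auto
  also have "\<dots> = prob ?B * measure ?U (\<Inter>j\<in>J. X j k -` {v} \<inter> space M)"
  proof -
    have "(\<Inter>j\<in>J. X j k -` {v} \<inter> space M) \<in> events"
      using False fin by (intro sets.finite_INT) (auto intro: measurable_sets[OF X])
    then show ?thesis
      using pos by (subst measure_uniform_measure) (simp_all add: emeasure_eq_measure)
  qed
  also have "measure ?U (\<Inter>j\<in>J. X j k -` {v} \<inter> space M) =
      (\<Prod>j\<in>J. measure ?U (X j k -` {v} \<inter> space M))"
    using U.indep_varsD[OF X_cond_indep[OF k], of J "\<lambda>_. {v}"] False fin J by simp
  also have "\<dots> = (\<Prod>j\<in>J. \<P>(\<omega> in M. X j k \<omega> = v \<bar> Y k \<omega> = y))"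
  proof (rule prod.cong[OF refl])
    fix j assume [simp]: "j \<in> J"
    have "measure ?U (X j k -` {v} \<inter> space M) = \<P>(\<omega> in ?U. X j k \<omega> = v)"
      by (intro arg_cong[where f="measure ?U"]) auto
    then show "measure ?U (X j k -` {v} \<inter> space M) = \<P>(\<omega> in M. X j k \<omega> = v \<bar> Y k \<omega> = y)"
      by (subst (asm) measure_uniform_measure_eq_cond_prob) auto
  qed
  finally show ?thesis .
qed simp

text \<open>Independence of the \<open>l\<close> vectors, applied to one rectangle for each
  \<open>k\<close>. With \<open>J = {}\<close> it yields the joint law of the background
  counts.\<close>

lemma prob_vector_hits:
  assumes l: "1 \<le> l" and J: "J \<subseteq> {1..d}"
  shows "prob {\<omega> \<in> space M. \<forall>k\<in>{1..l}. Y k \<omega> = y k \<and> (\<forall>j\<in>J. X j k \<omega> = v k)} =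
    (\<Prod>k\<in>{1..l}. prob {\<omega> \<in> space M. Y k \<omega> = y k \<and> (\<forall>j\<in>J. X j k \<omega> = v k)})"
proof -
  let ?Z = "\<lambda>k \<omega>. (Y k \<omega>, \<lambda>j\<in>{1..d}. X j k \<omega>)"
  \<comment> \<open>Coordinates outside \<open>J\<close> are left free, which keeps this a
    measurable rectangle over all of \<open>{1..d}\<close>.\<close>
  let ?A = "\<lambda>k. {y k} \<times> PiE {1..d} (\<lambda>j. if j \<in> J then {v k} else UNIV)"
  have hit: "?Z k -` ?A k \<inter> space M =
      {\<omega> \<in> space M. Y k \<omega> = y k \<and> (\<forall>j\<in>J. X j k \<omega> = v k)}" for k
    using J by (auto simp: PiE_iff split: if_splits)
  have "prob (\<Inter>k\<in>{1..l}. ?Z k -` ?A k \<inter> space M) = (\<Prod>k\<in>{1..l}. prob (?Z k -` ?A k \<inter> space M))"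
    using l by (intro indep_varsD[OF vectors_indep]) (auto intro!: pair_measureI sets_PiM_I_finite)
  moreover have "(\<Inter>k\<in>{1..l}. ?Z k -` ?A k \<inter> space M) =
      {\<omega> \<in> space M. \<forall>k\<in>{1..l}. Y k \<omega> = y k \<and> (\<forall>j\<in>J. X j k \<omega> = v k)}"
    unfolding hit using l by auto
  ultimately show ?thesis
    unfolding hit by simp
qed

text \<open>Index \<open>j\<close> scores a hit if \<open>X j k\<close> equals \<open>v k\<close>
  for every \<open>k\<close> simultaneously. Given the counts, hits are independent over
  \<open>j\<close> with probability the product over \<open>k\<close>, so
  \<open>prob_Diff_UN_indep\<close> gives the probability of no hit.\<close>

lemma prob_no_hit_given:
  assumes l: "1 \<le> l"
  shows "prob {\<omega> \<in> space M. (\<forall>k\<in>{1..l}. Y k \<omega> = y k) \<and>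
      (\<forall>j\<in>{1..d}. \<exists>k\<in>{1..l}. X j k \<omega> \<noteq> v k)} =
    prob {\<omega> \<in> space M. \<forall>k\<in>{1..l}. Y k \<omega> = y k} *
      (\<Prod>j\<in>{1..d}. 1 - (\<Prod>k\<in>{1..l}. \<P>(\<omega> in M. X j k \<omega> = v k \<bar> Y k \<omega> = y k)))"
    (is "_ = prob ?B * (\<Prod>j\<in>_. 1 - ?r j)")
proof -
  let ?A = "\<lambda>j. {\<omega> \<in> space M. \<forall>k\<in>{1..l}. X j k \<omega> = v k}"
  have hits: "prob {\<omega> \<in> ?B. \<forall>j\<in>J. \<omega> \<in> ?A j} =
      (\<Prod>k\<in>{1..l}. prob {\<omega> \<in> space M. Y k \<omega> = y k}) * (\<Prod>j\<in>J. ?r j)" if J: "J \<subseteq> {1..d}" for J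
  proof -
    have "prob {\<omega> \<in> ?B. \<forall>j\<in>J. \<omega> \<in> ?A j} =
        prob {\<omega> \<in> space M. \<forall>k\<in>{1..l}. Y k \<omega> = y k \<and> (\<forall>j\<in>J. X j k \<omega> = v k)}"
      by (intro arg_cong[where f=prob]) auto
    also have "\<dots> = (\<Prod>k\<in>{1..l}. prob {\<omega> \<in> space M. Y k \<omega> = y k}) *
        (\<Prod>k\<in>{1..l}. \<Prod>j\<in>J. \<P>(\<omega> in M. X j k \<omega> = v k \<bar> Y k \<omega> = y k))"
      unfolding prob_vector_hits[OF l J] prod.distrib[symmetric]
      using J by (intro prod.cong refl prob_component_hits)
    finally show ?thesis
      \<comment> \<open>The two preceding lemmas give a product over \<open>k\<close> outside and
        \<open>j\<close> inside; swapping collects one factor per index \<open>j\<close>.\<close>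
      by (subst (asm) prod.swap)
  qed
  have "prob (?B - (\<Union>j\<in>{1..d}. ?A j)) = prob ?B * (\<Prod>j\<in>{1..d}. 1 - ?r j)"
  proof (rule prob_Diff_UN_indep)
    show "?A j \<in> events" if "j \<in> {1..d}" for j
      using that by measurable
    show "prob {\<omega> \<in> ?B. \<forall>j\<in>J. \<omega> \<in> ?A j} = prob ?B * (\<Prod>j\<in>J. ?r j)" if "J \<subseteq> {1..d}" for J
      \<comment> \<open>The case of empty \<open>J\<close> identifies the product of the marginals
        with \<open>prob ?B\<close>.\<close>
      using hits[OF that] hits[of "{}"] by simp
  qed auto
  moreover have "?B - (\<Union>j\<in>{1..d}. ?A j) = {\<omega> \<in> space M. (\<forall>k\<in>{1..l}. Y k \<omega> = y k) \<and>
      (\<forall>j\<in>{1..d}. \<exists>k\<in>{1..l}. X j k \<omega> \<noteq> v k)}"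
    by auto
  ultimately show ?thesis
    by simp
qed

text \<open>The function \<open>v\<close> serves both extremes: the largest value is
  \<open>v y = y\<close> with \<open>q = p\<close>, the smallest is \<open>v y = 0\<close> with
  \<open>q = 1 - p\<close>. Either some count exceeds \<open>N\<close>, or the counts lie in a
  finite box. The bound involves only the parameters, not the probability space, so it can be
  compared across dimensions.\<close>

lemma prob_no_hit_le:
  assumes l: "1 \<le> l"
    and q: "\<And>j k y. j \<in> {1..d} \<Longrightarrow> k \<in> {1..l} \<Longrightarrow>
      \<P>(\<omega> in M. X j k \<omega> = v y \<bar> Y k \<omega> = y) = q j k ^ y"
  shows "prob {\<omega> \<in> space M. \<forall>j\<in>{1..d}. \<exists>k\<in>{1..l}. X j k \<omega> \<noteq> v (Y k \<omega>)} \<le>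
    (\<Sum>k\<in>{1..l}. measure_pmf.prob (poisson_pmf (\<theta> k)) {N<..}) +
    (\<Sum>y\<in>PiE {1..l} (\<lambda>_. {..N}). \<Prod>j\<in>{1..d}. 1 - (\<Prod>k\<in>{1..l}. q j k ^ y k))"
    (is "prob ?E \<le> _")
proof -
  let ?T = "\<lambda>k. {\<omega> \<in> space M. Y k \<omega> \<in> {N<..}}"
  let ?C = "\<lambda>y. {\<omega> \<in> space M. (\<forall>k\<in>{1..l}. Y k \<omega> = y k) \<and>
      (\<forall>j\<in>{1..d}. \<exists>k\<in>{1..l}. X j k \<omega> \<noteq> v (y k))}"
  let ?P = "PiE {1..l} (\<lambda>_. {..N})"
  have fin: "finite ?P"
    by (intro finite_PiE) auto
  have T: "?T k \<in> events" if "k \<in> {1..l}" for k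
    using measurable_sets[OF Y_measurable[OF that], of "{N<..}"]
    by (simp add: vimage_def Int_def conj_commute)
  have C: "?C y \<in> events" for y
    by measurable
  have "?E \<subseteq> (\<Union>k\<in>{1..l}. ?T k) \<union> (\<Union>y\<in>?P. ?C y)"
  proof
    fix \<omega> assume \<omega>: "\<omega> \<in> ?E"
    show "\<omega> \<in> (\<Union>k\<in>{1..l}. ?T k) \<union> (\<Union>y\<in>?P. ?C y)"
    proof (cases "\<exists>k\<in>{1..l}. N < Y k \<omega>")
      case False
      \<comment> \<open>The counts are restricted to \<open>{1..l}\<close> because members of
        \<open>PiE\<close> are extensional.\<close>
      then have "(\<lambda>k\<in>{1..l}. Y k \<omega>) \<in> ?P" "\<omega> \<in> ?C (\<lambda>k\<in>{1..l}. Y k \<omega>)"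
        using \<omega> by (auto simp: not_less)
      then show ?thesis by blast
    qed (use \<omega> in auto)
  qed
  then have "prob ?E \<le> prob ((\<Union>k\<in>{1..l}. ?T k) \<union> (\<Union>y\<in>?P. ?C y))"
    by (intro finite_measure_mono sets.Un sets.finite_UN T C fin finite_atLeastAtMost)
  also have "\<dots> \<le> prob (\<Union>k\<in>{1..l}. ?T k) + prob (\<Union>y\<in>?P. ?C y)"
    by (intro measure_Un_le sets.finite_UN T C fin finite_atLeastAtMost)
  also have "\<dots> \<le> (\<Sum>k\<in>{1..l}. prob (?T k)) + (\<Sum>y\<in>?P. prob (?C y))"
    by (intro add_mono finite_measure_subadditive_finite fin finite_atLeastAtMost)
      (use T C in blast)+
  also have "\<dots> \<le> (\<Sum>k\<in>{1..l}. measure_pmf.prob (poisson_pmf (\<theta> k)) {N<..}) +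
    (\<Sum>y\<in>?P. \<Prod>j\<in>{1..d}. 1 - (\<Prod>k\<in>{1..l}. q j k ^ y k))"
  proof (intro add_mono sum_mono)
    fix y
    let ?r = "\<lambda>j. \<Prod>k\<in>{1..l}. q j k ^ y k"
    have eq: "(\<Prod>k\<in>{1..l}. \<P>(\<omega> in M. X j k \<omega> = v (y k) \<bar> Y k \<omega> = y k)) = ?r j"
      if "j \<in> {1..d}" for j
      using that by (intro prod.cong q) auto
    have cond_le1: "\<P>(\<omega> in M. X j k \<omega> = v (y k) \<bar> Y k \<omega> = y k) \<le> 1" if "k \<in> {1..l}" for j k
    proof -
      have "{\<omega> \<in> space M. Y k \<omega> = y k} \<in> events"
        using measurable_sets[OF Y_measurable[OF that], of "{y k}"]
        by (simp add: vimage_def Int_def conj_commute)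
      then show ?thesis
        using prob_Y_pos[OF that, of "y k"]
        by (auto simp: cond_prob_def intro!: finite_measure_mono)
    qed
    \<comment> \<open>No range is assumed for \<open>q\<close>; the bound comes from reading the
      factors as conditional probabilities. It makes the product of the \<open>1 - ?r j\<close>
      nonnegative, so the weight of the counts can be replaced by \<open>1\<close>.\<close>
    have le1: "?r j \<le> 1" if "j \<in> {1..d}" for j
      unfolding eq[OF that, symmetric]
      by (intro prod_le_1 conjI cond_le1) (auto simp: cond_prob_def)
    have "prob (?C y) = prob {\<omega> \<in> space M. \<forall>k\<in>{1..l}. Y k \<omega> = y k} * (\<Prod>j\<in>{1..d}. 1 - ?r j)"
      unfolding prob_no_hit_given[OF l, where v="\<lambda>k. v (y k)"] using eq by simp
    also have "\<dots> \<le> 1 * (\<Prod>j\<in>{1..d}. 1 - ?r j)"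
      using le1 by (intro mult_right_mono prod_nonneg) auto
    finally show "prob (?C y) \<le> (\<Prod>j\<in>{1..d}. 1 - ?r j)"
      by simp
  qed (simp only: prob_Y)
  finally show ?thesis .
qed

section \<open>Maximum and minimum of the components in a fixed dimension\<close>

lemma component_measurable:
  assumes "j \<in> {1..d}"
  shows "component l X j \<in> measurable M (count_space UNIV)"
  unfolding component_def[abs_def] using assms by measurable

text \<open>Every subset of \<open>nat\<close> is Borel, so the Borel rules for finite maxima and
  minima apply; \<open>1 \<le> d\<close> makes the index set nonempty.\<close>

lemma extreme_component_measurable:
  assumes "1 \<le> d"
  shows "max_component d l X \<in> measurable M (count_space UNIV)"
    and "min_component d l X \<in> measurable M (count_space UNIV)"
proof -
  have "component l X j \<in> borel_measurable M" if "j \<in> {1..d}" for j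
    using component_measurable[OF that] by (simp add: measurable_def sets_borel_eq_count_space)
  then have "max_component d l X \<in> borel_measurable M" "min_component d l X \<in> borel_measurable M"
    unfolding max_component_def[abs_def] min_component_def[abs_def] using assms
    by (auto intro!: borel_measurable_Max borel_measurable_Min)
  then show "max_component d l X \<in> measurable M (count_space UNIV)"
    "min_component d l X \<in> measurable M (count_space UNIV)"
    by (auto simp: measurable_def sets_borel_eq_count_space)
qed

text \<open>The model prescribes conditional masses only at values \<open>z \<le> y\<close>. By the
  binomial theorem these already sum to \<open>1\<close>, which leaves no mass above
  \<open>y\<close>; countably many \<open>y\<close> are then combined.\<close>

lemma AE_component_le:
  assumes j: "j \<in> {1..d}" and k: "k \<in> {1..l}"
  shows "AE \<omega> in M. X j k \<omega> \<le> Y k \<omega>"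
proof -
  have [measurable]: "X j k \<in> measurable M (count_space UNIV)" "Y k \<in> measurable M (count_space UNIV)"
    using j k by (auto intro: measurable_components)
  have le: "AE \<omega> in M. Y k \<omega> = y \<longrightarrow> X j k \<omega> \<le> y" for y
  proof -
    let ?B = "{\<omega> \<in> space M. Y k \<omega> = y}"
    let ?A = "\<lambda>z. {\<omega> \<in> space M. X j k \<omega> = z \<and> Y k \<omega> = y}"
    have "prob (\<Union>z\<in>{..y}. ?A z) = (\<Sum>z\<le>y. prob (?A z))"
      by (intro finite_measure_finite_Union) (auto simp: disjoint_family_on_def)
    also have "\<dots> = (\<Sum>z\<le>y. real (y choose z) * p j k ^ z * (1 - p j k) ^ (y - z) * prob ?B)"
    proof (rule sum.cong[OF refl])
      fix z assume "z \<in> {..y}"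
      then show "prob (?A z) = real (y choose z) * p j k ^ z * (1 - p j k) ^ (y - z) * prob ?B"
        using X_cond_binomial[OF j k, of z y] prob_Y_pos[OF k, of y]
        by (simp add: cond_prob_def divide_eq_eq)
    qed
    also have "\<dots> = prob ?B"
      using binomial_ring[of "p j k" "1 - p j k" y] by (simp add: sum_distrib_right[symmetric])
    finally have "prob (?B - (\<Union>z\<in>{..y}. ?A z)) = 0"
      by (subst finite_measure_Diff) auto
    moreover have "?B - (\<Union>z\<in>{..y}. ?A z) = {\<omega> \<in> space M. \<not> (Y k \<omega> = y \<longrightarrow> X j k \<omega> \<le> y)}"
      by auto
    ultimately show ?thesis
      by (subst AE_iff_measurable) (auto simp: emeasure_eq_measure)
  qed
  have "AE \<omega> in M. \<forall>y. Y k \<omega> = y \<longrightarrow> X j k \<omega> \<le> y"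
    by (intro AE_all_countable[THEN iffD2] allI le)
  then show ?thesis
    by simp
qed

lemma AE_max_component_le:
  assumes "1 \<le> d"
  shows "AE \<omega> in M. max_component d l X \<omega> \<le> (\<Sum>k\<in>{1..l}. Y k \<omega>)"
proof -
  have "AE \<omega> in M. \<forall>j\<in>{1..d}. \<forall>k\<in>{1..l}. X j k \<omega> \<le> Y k \<omega>"
    by (intro AE_finite_allI AE_component_le) auto
  then show ?thesis
    by eventually_elim (use assms in \<open>auto simp: max_component_def component_def intro!: sum_mono\<close>)
qed

lemma no_hit_event[measurable]:
  "{\<omega> \<in> space M. \<forall>j\<in>{1..d}. \<exists>k\<in>{1..l}. X j k \<omega> \<noteq> v (Y k \<omega>)} \<in> events"
proof -
  have "{\<omega> \<in> space M. X j k \<omega> \<noteq> v (Y k \<omega>)} \<in> events" if "j \<in> {1..d}" "k \<in> {1..l}" for j k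
  proof -
    have "(\<lambda>\<omega>. real (X j k \<omega>)) \<in> borel_measurable M"
      "(\<lambda>\<omega>. real (v (Y k \<omega>))) \<in> borel_measurable M"
      using measurable_compose[OF X_measurable[OF that], of real borel]
        measurable_compose[OF Y_measurable[OF that(2)], of "\<lambda>y. real (v y)" borel] by auto
    from borel_measurable_neq[OF this] show ?thesis by simp
  qed
  then show ?thesis
    by (intro sets.sets_Collect_finite_All sets.sets_Collect_finite_Ex) auto
qed

text \<open>The maximum is almost surely at most the sum of the counts, which gives the lower bound.
  Unless every index misses, some component equals that sum, which gives the upper bound.\<close>

lemma cdf_max_component_bounds:
  fixes x :: nat
  assumes d: "1 \<le> d"
  defines "F \<equiv> rv_cdf M (\<lambda>\<omega>. \<Sum>k\<in>{1..l}. Y k \<omega>) (real x)"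
  shows "F \<le> rv_cdf M (max_component d l X) (real x)"
    and "rv_cdf M (max_component d l X) (real x) \<le>
      F + prob {\<omega> \<in> space M. \<forall>j\<in>{1..d}. \<exists>k\<in>{1..l}. X j k \<omega> \<noteq> Y k \<omega>}"
proof -
  let ?S = "\<lambda>\<omega>. \<Sum>k\<in>{1..l}. Y k \<omega>" and ?M = "max_component d l X"
  let ?E = "{\<omega> \<in> space M. \<forall>j\<in>{1..d}. \<exists>k\<in>{1..l}. X j k \<omega> \<noteq> Y k \<omega>}"
  have S[measurable]: "?S \<in> measurable M (count_space UNIV)"
    by measurable
  have M[measurable]: "?M \<in> measurable M (count_space UNIV)"
    using d by (rule extreme_component_measurable)
  have E[measurable]: "?E \<in> events"
    by (rule no_hit_event)
  have Sx: "{\<omega> \<in> space M. ?S \<omega> \<le> x} \<in> events"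
    by measurable
  have F: "F = prob {\<omega> \<in> space M. ?S \<omega> \<le> x}"
    unfolding F_def by (rule rv_cdf_eq_prob[OF S])
  show "F \<le> rv_cdf M ?M (real x)"
    unfolding F rv_cdf_eq_prob[OF M] using AE_max_component_le[OF d]
    by (intro finite_measure_mono_AE) auto
  have "{\<omega> \<in> space M. ?M \<omega> \<le> x} \<subseteq> {\<omega> \<in> space M. ?S \<omega> \<le> x} \<union> ?E"
  proof
    fix \<omega> assume \<omega>: "\<omega> \<in> {\<omega> \<in> space M. ?M \<omega> \<le> x}"
    show "\<omega> \<in> {\<omega> \<in> space M. ?S \<omega> \<le> x} \<union> ?E"
    proof (cases "\<omega> \<in> ?E")
      case False
      then obtain j where j: "j \<in> {1..d}" "\<forall>k\<in>{1..l}. X j k \<omega> = Y k \<omega>"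
        using \<omega> by auto
      then have "?S \<omega> = component l X j \<omega>"
        by (simp add: component_def)
      also have "\<dots> \<le> ?M \<omega>"
        unfolding max_component_def using j by (intro Max_ge) auto
      finally show ?thesis
        using \<omega> by auto
    qed simp
  qed
  then have "prob {\<omega> \<in> space M. ?M \<omega> \<le> x} \<le> prob ({\<omega> \<in> space M. ?S \<omega> \<le> x} \<union> ?E)"
    by (intro finite_measure_mono sets.Un Sx E)
  also have "\<dots> \<le> prob {\<omega> \<in> space M. ?S \<omega> \<le> x} + prob ?E"
    by (intro measure_Un_le Sx E)
  finally show "rv_cdf M ?M (real x) \<le> F + prob ?E"
    unfolding F rv_cdf_eq_prob[OF M] .
qed

text \<open>Unless every index misses the value \<open>0\<close>, some component vanishes and the
  minimum is \<open>0\<close>.\<close>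

lemma cdf_min_component_bounds:
  assumes d: "1 \<le> d"
  shows "1 - prob {\<omega> \<in> space M. \<forall>j\<in>{1..d}. \<exists>k\<in>{1..l}. X j k \<omega> \<noteq> 0} \<le>
      rv_cdf M (min_component d l X) (real x)"
    and "rv_cdf M (min_component d l X) (real x) \<le> 1"
proof -
  let ?m = "min_component d l X"
  let ?E = "{\<omega> \<in> space M. \<forall>j\<in>{1..d}. \<exists>k\<in>{1..l}. X j k \<omega> \<noteq> 0}"
  have m[measurable]: "?m \<in> measurable M (count_space UNIV)"
    using d by (rule extreme_component_measurable)
  have E: "?E \<in> events"
    using no_hit_event[of "\<lambda>_. 0"] by simp
  have "1 - prob ?E = prob (space M - ?E)"
    using E by (simp add: prob_compl)
  also have "\<dots> \<le> prob {\<omega> \<in> space M. ?m \<omega> \<le> x}"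
  proof (rule finite_measure_mono)
    show "space M - ?E \<subseteq> {\<omega> \<in> space M. ?m \<omega> \<le> x}"
    proof
      fix \<omega> assume \<omega>: "\<omega> \<in> space M - ?E"
      then obtain j where j: "j \<in> {1..d}" "component l X j \<omega> = 0"
        by (auto simp: component_def)
      then have "?m \<omega> \<le> component l X j \<omega>"
        unfolding min_component_def by (intro Min_le) auto
      then show "\<omega> \<in> {\<omega> \<in> space M. ?m \<omega> \<le> x}"
        using \<omega> j by simp
    qed
  qed auto
  finally show "1 - prob ?E \<le> rv_cdf M ?m (real x)"
    by (simp add: rv_cdf_eq_prob[OF m])
  show "rv_cdf M ?m (real x) \<le> 1"
    by (simp add: rv_cdf_eq_prob[OF m])
qed

text \<open>The left side is the probability that all counts vanish. It depends on neither
  \<open>d\<close> nor \<open>x\<close>, so it can serve as a uniform lower bound for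
  denominators.\<close>

lemma cdf_sum_lower_bound:
  assumes l: "1 \<le> l"
  shows "(\<Prod>k\<in>{1..l}. exp (- \<theta> k)) \<le> rv_cdf M (\<lambda>\<omega>. \<Sum>k\<in>{1..l}. Y k \<omega>) (real x)"
proof -
  have S[measurable]: "(\<lambda>\<omega>. \<Sum>k\<in>{1..l}. Y k \<omega>) \<in> measurable M (count_space UNIV)"
    by measurable
  have "(\<Prod>k\<in>{1..l}. exp (- \<theta> k)) = (\<Prod>k\<in>{1..l}. prob {\<omega> \<in> space M. Y k \<omega> = 0})"
    by (intro prod.cong refl) (simp add: prob_Y_eq)
  also have "\<dots> = prob {\<omega> \<in> space M. \<forall>k\<in>{1..l}. Y k \<omega> = 0}"
    using prob_vector_hits[OF l, of "{}" "\<lambda>_. 0"] by simp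
  also have "\<dots> \<le> prob {\<omega> \<in> space M. (\<Sum>k\<in>{1..l}. Y k \<omega>) \<le> x}"
    by (intro finite_measure_mono) auto
  finally show ?thesis
    unfolding rv_cdf_eq_prob[OF S] .
qed

end

section \<open>Vanishing of the miss probability as the dimension grows\<close>

text \<open>The inequality \<open>1 - t \<le> exp (- t)\<close> bounds the product by the
  exponential of minus a partial sum, and partial sums of a nonnegative divergent series tend to
  infinity.\<close>

lemma prod_one_minus_tendsto_0:
  fixes r :: "nat \<Rightarrow> real"
  assumes r: "\<And>j. 0 \<le> r j" "\<And>j. r j \<le> 1" and "\<not> summable r"
  shows "(\<lambda>n. \<Prod>j<n. 1 - r j) \<longlonglongrightarrow> 0"
proof (rule tendsto_sandwich[where f="\<lambda>_. 0" and h="\<lambda>n. exp (- (\<Sum>j<n. r j))"])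
  have "filterlim (\<lambda>n. \<Sum>j<n. r j) at_top sequentially"
    unfolding filterlim_at_top
  proof
    fix Z
    obtain n where n: "Z \<le> (\<Sum>j<n. r j)"
      using summableI_nonneg_bounded[of r Z] assms by (meson nle_le)
    have "Z \<le> (\<Sum>j<m. r j)" if "n \<le> m" for m
      using n sum_mono2[of "{..<m}" "{..<n}" r] r that by fastforce
    then show "\<forall>\<^sub>F n in sequentially. Z \<le> (\<Sum>j<n. r j)"
      by (rule eventually_sequentiallyI)
  qed
  then show "(\<lambda>n. exp (- (\<Sum>j<n. r j))) \<longlonglongrightarrow> 0"
    by (intro filterlim_compose[OF exp_at_bot] filterlim_compose[OF filterlim_uminus_at_bot_at_top])
  have "(\<Prod>j<n. 1 - r j) \<le> exp (- (\<Sum>j<n. r j))" for n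
  proof -
    have "(\<Prod>j<n. 1 - r j) \<le> (\<Prod>j<n. exp (- r j))"
      using r exp_ge_add_one_self[of "- r _"] by (intro prod_mono) auto
    then show ?thesis
      by (simp add: exp_sum sum_negf[symmetric])
  qed
  then show "\<forall>\<^sub>F n in sequentially. (\<Prod>j<n. 1 - r j) \<le> exp (- (\<Sum>j<n. r j))"
    by simp
  show "\<forall>\<^sub>F n in sequentially. 0 \<le> (\<Prod>j<n. 1 - r j)"
    using r by (auto intro!: always_eventually prod_nonneg)
qed simp

text \<open>The two alternatives of \<open>eventually_attaining\<close> are treated apart: a hit
  probability equal to \<open>1\<close> makes the product zero from that index on, and a divergent
  series of hit probabilities drives it to zero.\<close>

lemma eventually_attaining_prod_tendsto:
  assumes "eventually_attaining l q"
    and q: "\<And>j k. 1 \<le> j \<Longrightarrow> k \<in> {1..l} \<Longrightarrow> q j k \<in> {0..1}"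
  shows "(\<lambda>d. \<Prod>j\<in>{1..d}. 1 - (\<Prod>k\<in>{1..l}. q j k ^ y k)) \<longlonglongrightarrow> 0"
proof -
  let ?r = "\<lambda>j. \<Prod>k\<in>{1..l}. q j k ^ y k"
  consider j where "1 \<le> j" "?r j = 1" | "\<not> summable (\<lambda>j. ?r (Suc j))"
    using assms(1) unfolding eventually_attaining_def by blast
  then show ?thesis
  proof cases
    case (1 j)
    have "(\<Prod>j\<in>{1..d}. 1 - ?r j) = 0" if "j \<le> d" for d
      using 1 that by (intro prod_zero) (auto intro!: bexI[of _ j])
    then show ?thesis
      by (intro tendsto_eventually eventually_sequentiallyI)
  next
    case 2
    have "(\<lambda>d. \<Prod>j<d. 1 - ?r (Suc j)) \<longlonglongrightarrow> 0"
      using q 2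
      by (intro prod_one_minus_tendsto_0)
        (auto intro!: prod_nonneg prod_le_1 zero_le_power power_le_one)
    moreover have "(\<Prod>j<d. 1 - ?r (Suc j)) = (\<Prod>j\<in>{1..d}. 1 - ?r j)" for d
      by (rule prod.reindex_bij_witness[of _ "\<lambda>j. j - 1" Suc]) auto
    ultimately show ?thesis
      by simp
  qed
qed

text \<open>Half of \<open>e\<close> is spent on the tail of the counts and half on the box. The
  tail does not involve \<open>d\<close>, so \<open>N\<close> is fixed first; the box is then a
  fixed finite set, and the limit in \<open>d\<close> may be taken term by term.\<close>

lemma prob_no_hit_tendsto_0:
  fixes M :: "nat \<Rightarrow> 'a measure"
  assumes l: "1 \<le> l"
    and tdp: "\<And>d. 1 \<le> d \<Longrightarrow> thinning_dependence_poisson (M d) d l \<theta> p (Y d) (X d)"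
    and att: "eventually_attaining l q"
    and q01: "\<And>j k. 1 \<le> j \<Longrightarrow> k \<in> {1..l} \<Longrightarrow> q j k \<in> {0..1}"
    and q: "\<And>d j k y. 1 \<le> d \<Longrightarrow> j \<in> {1..d} \<Longrightarrow> k \<in> {1..l} \<Longrightarrow>
      \<P>(\<omega> in M d. X d j k \<omega> = v y \<bar> Y d k \<omega> = y) = q j k ^ y"
  shows "(\<lambda>d. measure (M d)
    {\<omega> \<in> space (M d). \<forall>j\<in>{1..d}. \<exists>k\<in>{1..l}. X d j k \<omega> \<noteq> v (Y d k \<omega>)}) \<longlonglongrightarrow> 0"
    (is "?f \<longlonglongrightarrow> 0")
proof (rule order_tendstoI)
  fix e :: real assume e: "0 < e"
  let ?tail = "\<lambda>N. \<Sum>k\<in>{1..l}. measure_pmf.prob (poisson_pmf (\<theta> k)) {N<..}"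
  let ?main = "\<lambda>N d. \<Sum>y\<in>PiE {1..l} (\<lambda>_. {..N}). \<Prod>j\<in>{1..d}. 1 - (\<Prod>k\<in>{1..l}. q j k ^ y k)"
  have decseq: "decseq (\<lambda>N::nat. {N<..})"
    by (auto simp: decseq_def)
  have Inter_greaterThan: "(\<Inter>N::nat. {N<..}) = {}"
    by auto
  have "(\<lambda>N. measure_pmf.prob (poisson_pmf (\<theta> k)) {N<..}) \<longlonglongrightarrow> 0" for k
    using measure_pmf.finite_Lim_measure_decseq[of "\<lambda>N::nat. {N<..}" "poisson_pmf (\<theta> k)"]
    by (simp add: decseq Inter_greaterThan)
  then have "?tail \<longlonglongrightarrow> (\<Sum>k\<in>{1..l}. 0)"
    by (intro tendsto_sum)
  then have "\<forall>\<^sub>F N in sequentially. ?tail N < e / 2"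
    using e by (intro order_tendstoD(2)[where y=0]) auto
  then obtain N where N: "?tail N < e / 2"
    by (auto simp: eventually_sequentially)
  have "?main N \<longlonglongrightarrow> (\<Sum>y\<in>PiE {1..l} (\<lambda>_. {..N}). 0)"
    by (intro tendsto_sum eventually_attaining_prod_tendsto[OF att q01])
  then have "\<forall>\<^sub>F d in sequentially. ?main N d < e / 2"
    using e by (intro order_tendstoD(2)[where y=0]) auto
  then show "\<forall>\<^sub>F d in sequentially. ?f d < e"
    using eventually_ge_at_top[of 1]
  proof eventually_elim
    case (elim d)
    have "?f d \<le> ?tail N + ?main N d"
      using thinning_dependence_poisson.prob_no_hit_le[OF tdp[OF elim(2)] l q[OF elim(2)]] .
    with N elim show ?case
      by linarith
  qed
next
  fix e :: real assume "e < 0"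
  then have "e < ?f d" for d
    by (rule less_le_trans) simp
  then show "\<forall>\<^sub>F d in sequentially. e < ?f d"
    by simp
qed

section \<open>Asymptotics of the two distribution functions\<close>

text \<open>Each dimension may live on its own probability space, with only the rates and thinning
  probabilities in common; hence the reliance on bounds in these parameters alone.\<close>

theorem proposition4p10:
  fixes M :: "nat \<Rightarrow> 'a measure"
    and l :: nat
    and \<theta> :: "nat \<Rightarrow> real"
    and p :: "nat \<Rightarrow> nat \<Rightarrow> real"
    and Y :: "nat \<Rightarrow> nat \<Rightarrow> 'a \<Rightarrow> nat"
    and X :: "nat \<Rightarrow> nat \<Rightarrow> nat \<Rightarrow> 'a \<Rightarrow> nat"
  assumes "l \<ge> 1"
    and "\<And>d. d \<ge> 1 \<Longrightarrow> thinning_dependence_poisson (M d) d l \<theta> p (Y d) (X d)"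
  shows "(eventually_attaining l p \<longrightarrow>
           (\<forall>x::nat. (\<lambda>d. rv_cdf (M d) (max_component d l (X d)) (real x) /
                     cdf_convolutions (\<lambda>k. rv_cdf (M d) (Y d k)) l (real x)) \<longlonglongrightarrow> 1))
       \<and> (eventually_attaining l (\<lambda>j k. 1 - p j k) \<longrightarrow>
           (\<forall>x::nat. (\<lambda>d. rv_cdf (M d) (min_component d l (X d)) (real x) / 1) \<longlonglongrightarrow> 1))
       \<and> (\<forall>d\<ge>1. cdf_convolutions (\<lambda>k. rv_cdf (M d) (Y d k)) l
                 = rv_cdf (M d) (\<lambda>\<omega>. \<Sum>k\<in>{1..l}. Y d k \<omega>))"
proof (intro conjI impI allI)
  note l = assms(1) and tdp = assms(2)
  \<comment> \<open>The model of dimension \<open>d = j\<close> is used, since it contains the index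
    \<open>j\<close>.\<close>
  have p01: "p j k \<in> {0..1}" if "1 \<le> j" "k \<in> {1..l}" for j k
    using thinning_dependence_poisson.thinning_prob[OF tdp[OF that(1)], of j k] that by simp
  show conv: "cdf_convolutions (\<lambda>k. rv_cdf (M d) (Y d k)) l =
      rv_cdf (M d) (\<lambda>\<omega>. \<Sum>k\<in>{1..l}. Y d k \<omega>)" if "1 \<le> d" for d
  proof -
    interpret thinning_dependence_poisson "M d" d l \<theta> p "Y d" "X d"
      using that by (rule tdp)
    show ?thesis
      by (rule cdf_convolutions_indep_vars[OF Y_indep l])
  qed
  show "(\<lambda>d. rv_cdf (M d) (max_component d l (X d)) (real x) /
      cdf_convolutions (\<lambda>k. rv_cdf (M d) (Y d k)) l (real x)) \<longlonglongrightarrow> 1"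
    if att: "eventually_attaining l p" for x :: nat
  proof -
    let ?F = "\<lambda>d. rv_cdf (M d) (max_component d l (X d)) (real x)"
    let ?G = "\<lambda>d. cdf_convolutions (\<lambda>k. rv_cdf (M d) (Y d k)) l (real x)"
    let ?E = "\<lambda>d. measure (M d)
      {\<omega> \<in> space (M d). \<forall>j\<in>{1..d}. \<exists>k\<in>{1..l}. X d j k \<omega> \<noteq> Y d k \<omega>}"
    define c where "c = (\<Prod>k\<in>{1..l}. exp (- \<theta> k))"
    have c: "0 < c"
      unfolding c_def by (intro prod_pos) auto
    have G: "c \<le> ?G d" if "1 \<le> d" for d
      using thinning_dependence_poisson.cdf_sum_lower_bound[OF tdp[OF that] l]
      by (simp add: conv[OF that] c_def)
    have F: "?G d \<le> ?F d" "?F d \<le> ?G d + ?E d" if "1 \<le> d" for d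
      unfolding conv[OF that]
      using thinning_dependence_poisson.cdf_max_component_bounds[OF tdp[OF that] that] by auto
    have E: "?E \<longlonglongrightarrow> 0"
    proof (rule prob_no_hit_tendsto_0[OF l tdp att p01, where v="\<lambda>y. y"])
      \<comment> \<open>This is the top binomial mass, \<open>z = y\<close>.\<close>
      show "\<P>(\<omega> in M d. X d j k \<omega> = y \<bar> Y d k \<omega> = y) = p j k ^ y"
        if "1 \<le> d" "j \<in> {1..d}" "k \<in> {1..l}" for d j k y
        using thinning_dependence_poisson.X_cond_binomial[OF tdp[OF that(1)] that(2,3), of y y]
        by simp
    qed
    show ?thesis
    proof (rule tendsto_sandwich[where f="\<lambda>_. 1" and h="\<lambda>d. 1 + ?E d / c"])
      show "\<forall>\<^sub>F d in sequentially. 1 \<le> ?F d / ?G d"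
        using eventually_ge_at_top[of 1]
      proof eventually_elim
        case (elim d)
        show ?case
          using c G[OF elim] F[OF elim] by simp
      qed
      show "\<forall>\<^sub>F d in sequentially. ?F d / ?G d \<le> 1 + ?E d / c"
        using eventually_ge_at_top[of 1]
      proof eventually_elim
        case (elim d)
        have "?F d / ?G d \<le> (?G d + ?E d) / ?G d"
          using c G[OF elim] F[OF elim] by (intro divide_right_mono) auto
        also have "\<dots> = 1 + ?E d / ?G d"
          using c G[OF elim] by (simp add: add_divide_distrib)
        \<comment> \<open>The constant \<open>c\<close> replaces the denominator, which may vary
          with \<open>d\<close>, and so turns the vanishing additive error into a vanishing relative
          error.\<close>
        also have "\<dots> \<le> 1 + ?E d / c"
          using c G[OF elim] by (intro add_left_mono divide_left_mono) auto
        finally show ?case .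
      qed
      show "(\<lambda>d. 1 + ?E d / c) \<longlonglongrightarrow> 1"
        using tendsto_add[OF tendsto_const tendsto_divide[OF E tendsto_const[of c]], of 1] c by simp
    qed simp
  qed
  show "(\<lambda>d. rv_cdf (M d) (min_component d l (X d)) (real x) / 1) \<longlonglongrightarrow> 1"
    if att: "eventually_attaining l (\<lambda>j k. 1 - p j k)" for x :: nat
  proof -
    let ?F = "\<lambda>d. rv_cdf (M d) (min_component d l (X d)) (real x) / 1"
    let ?E = "\<lambda>d. measure (M d) {\<omega> \<in> space (M d). \<forall>j\<in>{1..d}. \<exists>k\<in>{1..l}. X d j k \<omega> \<noteq> 0}"
    have E: "?E \<longlonglongrightarrow> 0"
    proof (rule prob_no_hit_tendsto_0[OF l tdp att, where v="\<lambda>_. 0"])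
      \<comment> \<open>This is the bottom binomial mass, \<open>z = 0\<close>.\<close>
      show "\<P>(\<omega> in M d. X d j k \<omega> = 0 \<bar> Y d k \<omega> = y) = (1 - p j k) ^ y"
        if "1 \<le> d" "j \<in> {1..d}" "k \<in> {1..l}" for d j k y
        using thinning_dependence_poisson.X_cond_binomial[OF tdp[OF that(1)] that(2,3), of 0 y]
        by simp
    qed (use p01 in auto)
    note bounds = thinning_dependence_poisson.cdf_min_component_bounds[OF tdp]
    show ?thesis
    proof (rule tendsto_sandwich[where f="\<lambda>d. 1 - ?E d" and h="\<lambda>_. 1"])
      show "\<forall>\<^sub>F d in sequentially. 1 - ?E d \<le> ?F d"
        using eventually_ge_at_top[of 1] by eventually_elim (use bounds(1) in simp)
      show "\<forall>\<^sub>F d in sequentially. ?F d \<le> 1"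
        using eventually_ge_at_top[of 1] by eventually_elim (use bounds(2) in simp)
      show "(\<lambda>d. 1 - ?E d) \<longlonglongrightarrow> 1"
        using tendsto_diff[OF tendsto_const E, of 1] by simp
    qed simp
  qed
qed

end
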